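(* Let $n$ be a positive integer, let $T = e_1 T_1 + e_2 T_2 \in L_1^{n}\times_e L_1^{n}$, where $T_1,T_2$ are $\mathbb{C}_1$-linear operators on $\mathbb{C}_1^n$, and let $\mathcal{B}_1$ be an ordered basis of $\mathbb{C}_1^n$. Put $A^- = [T_1]_{\mathcal{B}_1}$ and $A^+ = [T_2]_{\mathcal{B}_1}$. Then $T$ is a $\mathbb{C}_2$-idempotent operator if and only if $A = e_1 A^- + e_2 A^+$ is a $\mathbb{C}_2$-idempotent matrix.
   Context: $\mathbb{C}_1$ is the field of complex numbers (imaginary unit $i_1$). The bicomplex numbers are $\mathbb{C}_2 = \{z_1 + i_2 z_2 : z_1,z_2\in\mathbb{C}_1\}$, a commutative ring with $i_1^2=i_2^2=-1$ and $i_1 i_2 = i_2 i_1$. Put $e_1 = (1+i_1 i_2)/2$ and $e_2 = (1-i_1 i_2)/2$; these satisfy $e_1^2=e_1$, $e_2^2=e_2$, $e_1e_2=0$, $e_1+e_2=1$. Every $\xi = z_1+i_2 z_2\in\mathbb{C}_2$ is written uniquely as $\xi = \xi^- e_1 + \xi^+ e_2$ with $\xi^- = z_1 - i_1 z_2$ and $\xi^+ = z_1 + i_1 z_2$ in $\mathbb{C}_1$. For $\mathbb{C}_1$-linear operators $T_1,T_2$ on $\mathbb{C}_1^n$, the $\mathbb{C}_1$-linear operator $e_1T_1+e_2T_2:\mathbb{C}_2^n\to\mathbb{C}_2^n$ is defined by $$(e_1T_1+e_2T_2)(\xi_1,\dots,\xi_n) = e_1\cdot T_1(\xi_1^-,\dots,\xi_n^-)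 + e_2\cdot T_2(\xi_1^+,\dots,\xi_n^+).$$ The set of all such operators is denoted $L_1^n\times_e L_1^n$. An operator $T\in L_1^n\times_e L_1^n$ is called $\mathbb{C}_2$-idempotent if $T^2 = T\circ T = T$. $[T_j]_{\mathcal{B}_1}$ denotes the (complex $n\times n$) matrix of $T_j$ with respect to $\mathcal{B}_1$. A matrix $A\in\mathbb{C}_2^{n\times n}$ (an $n\times n$ matrix with bicomplex entries) is called $\mathbb{C}_2$-idempotent if $A^2=A$; matrices over $\mathbb{C}_2$ are multiplied and scaled in the usual way. *)

theory Defs
  imports "HOL-Analysis.Analysis"
begin

(* Bicomplex z1 z2 stands for z1 + i2 z2. *)
datatype bicomplex = Bicomplex (bc_fst: complex) (bc_snd: complex)

lemma bicomplex_eqI: "bc_fst x = bc_fst y \<Longrightarrow> bc_snd x = bc_snd y \<Longrightarrow> x = y"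
  by (cases x; cases y) simp

instantiation bicomplex :: comm_ring_1
begin

definition "0 = Bicomplex 0 0"
definition "1 = Bicomplex 1 0"
definition "x + y = Bicomplex (bc_fst x + bc_fst y) (bc_snd x + bc_snd y)"
definition "- x = Bicomplex (- bc_fst x) (- bc_snd x)"
definition "x - y = Bicomplex (bc_fst x - bc_fst y) (bc_snd x - bc_snd y)"
definition "x * y = Bicomplex (bc_fst x * bc_fst y - bc_snd x * bc_snd y)
                              (bc_fst x * bc_snd y + bc_snd x * bc_fst y)"

instance
  by standard
    (simp_all add: zero_bicomplex_def one_bicomplex_def plus_bicomplex_def
      uminus_bicomplex_def minus_bicomplex_def times_bicomplex_def algebra_simps)

end

definition bc_of_complex :: "complex \<Rightarrow> bicomplex" where
  "bc_of_complex z = Bicomplex z 0"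

definition bc_i1 :: bicomplex where "bc_i1 = bc_of_complex \<i>"
definition bc_i2 :: bicomplex where "bc_i2 = Bicomplex 0 1"

definition bc_e1 :: bicomplex where
  "bc_e1 = bc_of_complex (1 / 2) * (1 + bc_i1 * bc_i2)"

definition bc_e2 :: bicomplex where
  "bc_e2 = bc_of_complex (1 / 2) * (1 - bc_i1 * bc_i2)"

definition bc_minus :: "bicomplex \<Rightarrow> complex" where
  "bc_minus \<xi> = bc_fst \<xi> - \<i> * bc_snd \<xi>"

definition bc_plus :: "bicomplex \<Rightarrow> complex" where
  "bc_plus \<xi> = bc_fst \<xi> + \<i> * bc_snd \<xi>"

lemmas bc_defs = zero_bicomplex_def one_bicomplex_def plus_bicomplex_def
  uminus_bicomplex_def minus_bicomplex_def times_bicomplex_def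
  bc_of_complex_def bc_i1_def bc_i2_def bc_e1_def bc_e2_def bc_minus_def bc_plus_def

lemma bicomplex_cartesian: "Bicomplex z w = bc_of_complex z + bc_i2 * bc_of_complex w"
  by (simp add: bc_defs)

lemma bc_units: "bc_i1 * bc_i1 = -1" "bc_i2 * bc_i2 = -1" "bc_i1 * bc_i2 = bc_i2 * bc_i1"
  by (simp_all add: bc_defs)

lemma bc_idempotents:
  "bc_e1 * bc_e1 = bc_e1" "bc_e2 * bc_e2 = bc_e2" "bc_e1 * bc_e2 = 0" "bc_e1 + bc_e2 = 1"
  by (simp_all add: bc_defs)

lemma bc_idempotent_decomposition:
  "\<xi> = bc_of_complex (bc_minus \<xi>) * bc_e1 + bc_of_complex (bc_plus \<xi>) * bc_e2"
  by (rule bicomplex_eqI) (simp_all add: bc_defs field_simps)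

lemma bc_idempotent_unique:
  "bc_of_complex a * bc_e1 + bc_of_complex b * bc_e2 = \<xi> \<Longrightarrow> a = bc_minus \<xi> \<and> b = bc_plus \<xi>"
  by (auto simp: bc_defs field_simps)

definition bc_vec :: "complex ^ 'n \<Rightarrow> bicomplex ^ 'n" where
  "bc_vec v = (\<chi> i. bc_of_complex (v $ i))"

definition e_op ::
    "(complex ^ 'n \<Rightarrow> complex ^ 'n) \<Rightarrow> (complex ^ 'n \<Rightarrow> complex ^ 'n) \<Rightarrow> bicomplex ^ 'n \<Rightarrow> bicomplex ^ 'n" where
  "e_op T1 T2 \<xi> =
     bc_e1 *s bc_vec (T1 (\<chi> i. bc_minus (\<xi> $ i))) + bc_e2 *s bc_vec (T2 (\<chi> i. bc_plus (\<xi> $ i)))"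

(* The constant linear of HOL-Analysis means real-linear; linearity over the complex numbers
   is linearity with respect to the scaling *s. *)
definition clinear_op :: "(complex ^ 'n \<Rightarrow> complex ^ 'n) \<Rightarrow> bool" where
  "clinear_op T \<longleftrightarrow> Vector_Spaces.linear (*s) (*s) T"

definition L_times_e :: "(bicomplex ^ 'n \<Rightarrow> bicomplex ^ 'n) set" where
  "L_times_e = {e_op T1 T2 | T1 T2. clinear_op T1 \<and> clinear_op T2}"

definition bc_idempotent_op :: "(bicomplex ^ 'n \<Rightarrow> bicomplex ^ 'n) \<Rightarrow> bool" where
  "bc_idempotent_op T \<longleftrightarrow> T \<in> L_times_e \<and> T \<circ> T = T"

(* Families indexed by the coordinate type 'n play the role of ordered bases: b j is the
   basis vector in position j, and 'n also indexes the rows and columns of the matrices. *)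
definition ordered_basis :: "('n \<Rightarrow> complex ^ 'n) \<Rightarrow> bool" where
  "ordered_basis b \<longleftrightarrow> inj b \<and> vec.independent (range b) \<and> vec.span (range b) = UNIV"

(* Column j consists of the coordinates of T (b j) with respect to b. *)
definition matrix_wrt :: "('n \<Rightarrow> complex ^ 'n) \<Rightarrow> (complex ^ 'n \<Rightarrow> complex ^ 'n) \<Rightarrow> complex ^ 'n ^ 'n" where
  "matrix_wrt b T = (\<chi> i j. vec.representation (range b) (T (b j)) (b i))"

definition bc_mat :: "complex ^ 'n ^ 'm \<Rightarrow> bicomplex ^ 'n ^ 'm" where
  "bc_mat A = (\<chi> i j. bc_of_complex (A $ i $ j))"

definition bc_scale_mat :: "bicomplex \<Rightarrow> bicomplex ^ 'n ^ 'm \<Rightarrow> bicomplex ^ 'n ^ 'm" where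
  "bc_scale_mat c A = (\<chi> i j. c * A $ i $ j)"

definition bc_idempotent_mat :: "bicomplex ^ 'n ^ 'n \<Rightarrow> bool" where
  "bc_idempotent_mat A \<longleftrightarrow> A ** A = A"

end

theory Submission
  imports Defs
begin

text \<open>The projections \<^const>\<open>bc_minus\<close> and \<^const>\<open>bc_plus\<close> are ring homomorphisms that jointly
  identify the bicomplex numbers with two copies of the complex numbers. Under this identification
  \<open>T\<close> becomes the pair \<open>(T1, T2)\<close> and \<open>A\<close> the pair of their matrices, so the claim splits into the
  two complex statements that an operator is idempotent iff its matrix is. These hold because
  taking the matrix with respect to a basis is injective and multiplicative.\<close>

lemma bicomplex_eq_iff: "x = y \<longleftrightarrow> bc_minus x = bc_minus y \<and> bc_plus x = bc_plus y"
  by (metis bc_idempotent_decomposition)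

lemma bc_minus_simps [simp]:
  "bc_minus 0 = 0" "bc_minus (x + y) = bc_minus x + bc_minus y"
  "bc_minus (x * y) = bc_minus x * bc_minus y"
  "bc_minus (bc_of_complex z) = z" "bc_minus bc_e1 = 1" "bc_minus bc_e2 = 0"
  by (simp_all add: bc_defs algebra_simps)

lemma bc_plus_simps [simp]:
  "bc_plus 0 = 0" "bc_plus (x + y) = bc_plus x + bc_plus y"
  "bc_plus (x * y) = bc_plus x * bc_plus y"
  "bc_plus (bc_of_complex z) = z" "bc_plus bc_e1 = 0" "bc_plus bc_e2 = 1"
  by (simp_all add: bc_defs algebra_simps)

lemma bc_minus_sum [simp]: "bc_minus (sum f S) = (\<Sum>i\<in>S. bc_minus (f i))"
  by (induction S rule: infinite_finite_induct) simp_all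

lemma bc_plus_sum [simp]: "bc_plus (sum f S) = (\<Sum>i\<in>S. bc_plus (f i))"
  by (induction S rule: infinite_finite_induct) simp_all

text \<open>\<open>bc_minus\<close> sends \<open>bc_e1\<close> to 1 and \<open>bc_e2\<close> to 0,
  and \<open>bc_plus\<close> does the opposite, so each projection keeps exactly one summand of
  \<open>e_op\<close>.\<close>

lemma bc_minus_e_op: "bc_minus (e_op T1 T2 \<xi> $ i) = T1 (\<chi> j. bc_minus (\<xi> $ j)) $ i"
  and bc_plus_e_op: "bc_plus (e_op T1 T2 \<xi> $ i) = T2 (\<chi> j. bc_plus (\<xi> $ j)) $ i"
  by (simp_all add: e_op_def bc_vec_def)

text \<open>Each projection of the output depends only on the same projection of the input, so the
  two components never mix.\<close>

lemma e_op_comp: "e_op S1 S2 \<circ> e_op T1 T2 = e_op (S1 \<circ> T1) (S2 \<circ> T2)"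
  by (simp add: fun_eq_iff vec_eq_iff bicomplex_eq_iff bc_minus_e_op bc_plus_e_op)

lemma e_op_eq_iff: "e_op S1 S2 = e_op T1 T2 \<longleftrightarrow> S1 = T1 \<and> S2 = T2"
proof
  assume eq: "e_op S1 S2 = e_op T1 T2"
  have "S1 v = T1 v \<and> S2 v = T2 v" for v
  proof -
    \<comment> \<open>Both projections of \<open>bc_vec v\<close> are \<open>v\<close>, so this one
      input tests both pairs of operators at \<open>v\<close>.\<close>
    have "e_op S1 S2 (bc_vec v) $ i = e_op T1 T2 (bc_vec v) $ i" for i
      using eq by simp
    then show ?thesis
      by (simp add: bicomplex_eq_iff bc_minus_e_op bc_plus_e_op bc_vec_def vec_eq_iff)
  qed
  then show "S1 = T1 \<and> S2 = T2" by auto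
qed simp

lemma bc_idempotent_mat_iff:
  "bc_idempotent_mat (bc_scale_mat bc_e1 (bc_mat P) + bc_scale_mat bc_e2 (bc_mat Q))
    \<longleftrightarrow> P ** P = P \<and> Q ** Q = Q"
  by (auto simp: bc_idempotent_mat_def bc_scale_mat_def bc_mat_def matrix_matrix_mult_def
      vec_eq_iff bicomplex_eq_iff)

text \<open>Injectivity of \<open>b\<close> turns the library's sum over the set
  \<open>range b\<close> into a sum over the indices.\<close>

lemma ordered_basis_expansion:
  assumes "ordered_basis b"
  shows "(\<Sum>i\<in>UNIV. vec.representation (range b) v (b i) *s b i) = v"
proof -
  have "(\<Sum>x\<in>range b. vec.representation (range b) v x *s x) = v"
    using assms by (intro vec.sum_representation_eq) (auto simp: ordered_basis_def)
  then show ?thesis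
    using assms by (simp add: ordered_basis_def sum.reindex)
qed

lemma matrix_wrt_basis_image:
  assumes "ordered_basis b"
  shows "T (b j) = (\<Sum>i\<in>UNIV. matrix_wrt b T $ i $ j *s b i)"
  using ordered_basis_expansion[OF assms, of "T (b j)"] by (simp add: matrix_wrt_def)

lemma clinear_op_sum:
  assumes "clinear_op T"
  shows "T (\<Sum>i\<in>I. c i *s v i) = (\<Sum>i\<in>I. c i *s T (v i))"
proof -
  interpret T: Vector_Spaces.linear "(*s)" "(*s)" T
    using assms by (simp add: clinear_op_def)
  show ?thesis by (simp add: T.sum T.scale)
qed

lemma clinear_op_comp: "clinear_op S \<Longrightarrow> clinear_op T \<Longrightarrow> clinear_op (S \<circ> T)"
  unfolding clinear_op_def by (rule Vector_Spaces.linear_compose)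

text \<open>The columns determine the images of the basis vectors, and these determine a linear
  operator through the basis expansion of its argument.\<close>

lemma matrix_wrt_inject:
  assumes b: "ordered_basis b" and S: "clinear_op S" and T: "clinear_op T"
  shows "matrix_wrt b S = matrix_wrt b T \<longleftrightarrow> S = T"
proof
  assume "matrix_wrt b S = matrix_wrt b T"
  then have basis: "S (b j) = T (b j)" for j
    using matrix_wrt_basis_image[OF b, of S j] matrix_wrt_basis_image[OF b, of T j] by simp
  show "S = T"
  proof
    fix v
    let ?v = "\<Sum>i\<in>UNIV. vec.representation (range b) v (b i) *s b i"
    have "S ?v = T ?v"
      by (simp add: clinear_op_sum[OF S] clinear_op_sum[OF T] basis)
    then show "S v = T v"
      by (simp add: ordered_basis_expansion[OF b])
  qed
qed simp

lemma matrix_wrt_comp: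
  assumes b: "ordered_basis b" and S: "clinear_op S"
  shows "matrix_wrt b (S \<circ> T) = matrix_wrt b S ** matrix_wrt b T"
proof -
  have ind: "vec.independent (range b)" and span: "\<And>v. v \<in> vec.span (range b)"
    using b by (auto simp: ordered_basis_def)
  have "vec.representation (range b) (S (T (b j))) (b i) =
      (\<Sum>k\<in>UNIV. matrix_wrt b S $ i $ k * matrix_wrt b T $ k $ j)" for i j
  proof -
    have "S (T (b j)) = (\<Sum>k\<in>UNIV. matrix_wrt b T $ k $ j *s S (b k))"
      by (subst matrix_wrt_basis_image[OF b, of T]) (rule clinear_op_sum[OF S])
    then show ?thesis
      \<comment> \<open>Taking the coordinate at \<open>b i\<close> is linear, and that coordinate
        of \<open>S (b k)\<close> is the matrix entry in row \<open>i\<close>, column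
        \<open>k\<close>.\<close>
      by (simp add: vec.representation_sum[OF ind span] vec.representation_scale[OF ind span]
          matrix_wrt_def mult.commute)
  qed
  then show ?thesis
    by (simp add: vec_eq_iff matrix_matrix_mult_def) (simp add: matrix_wrt_def)
qed

text \<open>The matrix square is the matrix of \<open>T \<circ> T\<close>, which is again linear, so
  injectivity applies to \<open>T \<circ> T\<close> and \<open>T\<close>.\<close>

lemma matrix_wrt_idempotent_iff:
  assumes "ordered_basis b" "clinear_op T"
  shows "matrix_wrt b T ** matrix_wrt b T = matrix_wrt b T \<longleftrightarrow> T \<circ> T = T"
  by (simp add: assms clinear_op_comp matrix_wrt_inject flip: matrix_wrt_comp)

theorem theorem4p5:
  fixes T1 T2 :: "complex ^ 'n \<Rightarrow> complex ^ 'n"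
    and T :: "bicomplex ^ 'n \<Rightarrow> bicomplex ^ 'n"
    and b :: "'n \<Rightarrow> complex ^ 'n"
    and A_minus A_plus :: "complex ^ 'n ^ 'n"
    and A :: "bicomplex ^ 'n ^ 'n"
  assumes "clinear_op T1" and "clinear_op T2"
    and "T = e_op T1 T2"
    and "ordered_basis b"
    and "A_minus = matrix_wrt b T1" and "A_plus = matrix_wrt b T2"
    and "A = bc_scale_mat bc_e1 (bc_mat A_minus) + bc_scale_mat bc_e2 (bc_mat A_plus)"
  shows "bc_idempotent_op T \<longleftrightarrow> bc_idempotent_mat A"
proof -
  \<comment> \<open>Membership in \<open>L_times_e\<close> holds by linearity of \<open>T1\<close>
    and \<open>T2\<close>. What remains is an equation between two \<open>e_op\<close> terms, which
    splits by uniqueness of the components.\<close>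
  have "bc_idempotent_op T \<longleftrightarrow> T1 \<circ> T1 = T1 \<and> T2 \<circ> T2 = T2"
    using assms(1-3) by (auto simp: bc_idempotent_op_def L_times_e_def e_op_comp e_op_eq_iff)
  also have "\<dots> \<longleftrightarrow> bc_idempotent_mat A"
    using assms by (simp add: bc_idempotent_mat_iff matrix_wrt_idempotent_iff)
  finally show ?thesis .
qed

end
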